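(* Let $m, s$ be positive integers with $\lfloor 2m/s \rfloor = 2$, and let $x = m/s$. Then $f(m,s) = 1/3$ if and only if there is an integer $b > 0$ with \[ \frac{3b+1}{3b} \le x < \frac{3b}{3b-1}; \] otherwise $f(m,s) > 1/3$.
   Context: The muffin problem with $m$ muffins and $s$ students (positive integers) asks to cut each of $m$ muffins of size $1$ into finitely many pieces of positive size and to assign every piece to one of $s$ students so that each student receives pieces of total size $m/s$. $f(m,s)$ denotes the maximum, over all such divisions and assignments, of the size of the smallest piece. *)

theory Defs
  imports Complex_Main
begin

text \<open>A division for the muffin problem with m muffins and s students is a finite list of
  pieces (i, j, a): a piece of muffin i (i < m), of positive size a, given to student j (j < s).
  Every muffin is used up exactly, and every student receives total size m/s.\<close>

definition muffin_division :: "nat \<Rightarrow> nat \<Rightarrow> (nat \<times> nat \<times> real) list \<Rightarrow> bool" where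
  "muffin_division m s P \<longleftrightarrow>
     (\<forall>(i, j, a) \<in> set P. i < m \<and> j < s \<and> 0 < a) \<and>
     (\<forall>i < m. sum_list [a. (i', j, a) \<leftarrow> P, i' = i] = 1) \<and>
     (\<forall>j < s. sum_list [a. (i, j', a) \<leftarrow> P, j' = j] = real m / real s)"

definition smallest_piece :: "(nat \<times> nat \<times> real) list \<Rightarrow> real" where
  "smallest_piece P = Min (set (map (\<lambda>(i, j, a). a) P))"

definition muffin_f :: "nat \<Rightarrow> nat \<Rightarrow> real" where
  "muffin_f m s = Sup {smallest_piece P | P. muffin_division m s P}"

end

theory Submission
  imports Defs
begin

text \<open>
  Put n = m - s and d = x - 1 = n/s. If all pieces exceed 1/3, every muffin has at most two
  pieces and every student two or three, and the muffins and two-piece students line up in chains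
  joining three-piece students: following a muffin and then a two-piece student shifts the piece
  size by d. A chain with k two-piece students ends in pieces with sum 1 - k d. All ends exceed
  1/3, so k d < 1/3; there are 3n chains, and they have to absorb all two-piece students. For x
  in one of the intervals this is impossible; the corresponding linear programming dual is a weight on
  pieces whose sum is at most 3b - 1 on every muffin and at least 3b on every student.

  Conversely, a division is a 3-regular multigraph on the 2n three-piece students with the 3n
  chains as edges, the length 1 - k d of every edge being split between its two ends so that
  each vertex receives x. If s = (3c + 2)n - L with 0 <= L < 2n, then L chains with
  k = c - 1 and 3n - L chains with k = c suffice, placed around a cycle as evenly as possible,
  by a rotation of Z/n or Z/2n. If s = (3c + 2)n + T with 0 < T <= n, all chains have k = c
  and T muffins are cut into thirds.
\<close>

section \<open>Upper bound\<close>

text \<open>On the lower half of (1/3, 2/3), the weight W(y) is b plus the number of the points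
  1/3 + d, 1/3 + 2d, ... below y. It is continued so that W(y) + W(1 - y) = 3b - 1 off the
  midpoint. The value from 2/3 on matters only for uncut muffins.\<close>

definition piece_weight :: "real \<Rightarrow> int \<Rightarrow> real \<Rightarrow> int" where
  "piece_weight d b y =
     (if y \<ge> 2/3 then 3 * b - 1
      else if y \<le> 1/2 then b + \<lceil>(y - 1/3) / d\<rceil> - 1
      else 2 * b - \<lceil>(2/3 - y) / d\<rceil>)"

text \<open>Here d = x - 1, and \<open>d_ge\<close> is the lower end of the interval for x. The
  upper end enters only in the final count over all students and muffins.\<close>

locale piece_weight_bounds =
  fixes d :: real and b :: int
  assumes d_pos: "0 < d" and b_pos: "0 < b"
    and d_ge: "1 \<le> 3 * of_int b * d"
begin

text \<open>This settles students with three or more pieces. In the upper branch it rests on (2/3 -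
  y)/d < 1/(3d) \<le> b.\<close>

lemma piece_weight_ge: "1/3 < y \<Longrightarrow> b \<le> piece_weight d b y"
proof -
  assume y: "1/3 < y"
  have 1: "1 \<le> \<lceil>(y - 1/3) / d\<rceil>"
    using y d_pos by (simp add: one_le_ceiling)
  have 2: "\<lceil>(2/3 - y) / d\<rceil> \<le> b"
    using y d_pos d_ge by (simp add: ceiling_le_iff pos_divide_le_eq)
  show ?thesis using 1 2 b_pos unfolding piece_weight_def by auto
qed

text \<open>The midpoint is its own complement, so the symmetry of the two branches does not apply.
  From 1/(6d) \<le> b/2 the ceiling is at most \<open>(b + 1) div 2\<close>, and the rounding leaves
  just 3b - 1.\<close>

lemma piece_weight_half: "2 * piece_weight d b (1/2) \<le> 3 * b - 1"
proof -
  have "(1/6) / d \<le> of_int b / 2"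
    using d_pos d_ge by (simp add: pos_divide_le_eq)
  hence "\<lceil>(1/6) / d\<rceil> \<le> \<lceil>of_int b / (2::real)\<rceil>" by (rule ceiling_mono)
  moreover have "\<lceil>of_int b / (2::real)\<rceil> \<le> (b + 1) div 2"
  proof -
    have "b \<le> 2 * ((b + 1) div 2)" by presburger
    hence "of_int b \<le> 2 * (of_int ((b + 1) div 2) :: real)" by linarith
    thus ?thesis by (simp add: ceiling_le_iff)
  qed
  ultimately show ?thesis unfolding piece_weight_def by simp
qed

lemma piece_weight_muffin_le:
  assumes "1/3 < y" "y < 2/3"
  shows "piece_weight d b y + piece_weight d b (1 - y) \<le> 3 * b - 1"
proof -
  have *: "piece_weight d b z + piece_weight d b (1 - z) \<le> 3 * b - 1"
    if "1/3 < z" "z \<le> 1/2" for z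
  proof (cases "z = 1/2")
    case True
    show ?thesis using piece_weight_half unfolding True by simp
  next
    case False
    have "2/3 - (1 - z) = z - 1/3" by simp
    thus ?thesis using that False unfolding piece_weight_def by simp
  qed
  show ?thesis
  proof (cases "y \<le> 1/2")
    case True
    thus ?thesis using * assms by simp
  next
    case False
    thus ?thesis using *[of "1 - y"] assms by simp
  qed
qed

lemma piece_weight_student_ge:
  assumes "1/3 < y" "y < 2/3" "1/3 < z" "z < 2/3" "y + z = 1 + d"
  shows "3 * b \<le> piece_weight d b y + piece_weight d b z"
proof -
  have *: "3 * b \<le> piece_weight d b y + piece_weight d b z"
    if "y \<le> 1/2" "1/3 < y" "z < 2/3" "y + z = 1 + d" for y z
  proof -
    \<comment> \<open>The two ceilings differ by exactly one, so the weights add up to 3b.\<close>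
    have "(2/3 - z) / d = (y - 1/3) / d - 1"
      using that d_pos by (simp add: field_simps)
    thus ?thesis using that d_pos unfolding piece_weight_def by simp
  qed
  consider "y \<le> 1/2" | "z \<le> 1/2" | "y > 1/2" "z > 1/2" by linarith
  thus ?thesis
  proof cases
    case 1
    thus ?thesis using * assms by blast
  next
    case 2
    thus ?thesis using *[of z y] assms by (simp add: add.commute)
  next
    case 3
    \<comment> \<open>The two quotients sum to at most b - 1. Rounding up adds less than 2, so the
      ceilings sum to at most b, and the weight is at least 4b - b.\<close>
    have "(2/3 - y) + (2/3 - z) = 1/3 - d" using assms(5) by simp
    hence "(2/3 - y) / d + (2/3 - z) / d = (1/3 - d) / d"
      by (metis add_divide_distrib)
    hence "(2/3 - y) / d + (2/3 - z) / d = (1/3) / d - 1"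
      using d_pos by (simp add: diff_divide_distrib)
    moreover have "(1/3) / d \<le> of_int b"
      using d_pos d_ge by (simp add: pos_divide_le_eq)
    ultimately have "\<lceil>(2/3 - y) / d\<rceil> + \<lceil>(2/3 - z) / d\<rceil> \<le> b" by linarith
    thus ?thesis using 3 assms unfolding piece_weight_def by simp
  qed
qed

text \<open>Three pieces above 1/3 exceed a muffin. A piece in [2/3, 1) would leave a partner of at
  most 1/3; this gives the second claim, which the student bound needs.\<close>

lemma sum_piece_weight_muffin_le:
  assumes "\<forall>y\<in>set ys. 1/3 < y" "sum_list ys = 1"
  shows "sum_list (map (piece_weight d b) ys) \<le> 3 * b - 1"
    and "\<forall>y\<in>set ys. y = 1 \<or> y < 2/3"
proof -
  consider "ys = []" | y where "ys = [y]" | y z where "ys = [y, z]"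
    | x y z zs where "ys = x # y # z # zs"
    by (cases ys rule: remdups_adj.cases) (auto, metis list.exhaust)
  hence "sum_list (map (piece_weight d b) ys) \<le> 3 * b - 1 \<and> (\<forall>y\<in>set ys. y = 1 \<or> y < 2/3)"
  proof cases
    case 1
    thus ?thesis using assms by simp
  next
    case 2
    thus ?thesis using assms by (simp add: piece_weight_def)
  next
    case (3 y z)
    hence "z = 1 - y" using assms by simp
    thus ?thesis using 3 assms piece_weight_muffin_le[of y] by simp
  next
    case (4 x y z zs)
    have "0 \<le> sum_list zs" using assms(1) 4 by (intro sum_list_nonneg) force
    thus ?thesis using 4 assms by auto
  qed
  thus "sum_list (map (piece_weight d b) ys) \<le> 3 * b - 1"
    and "\<forall>y\<in>set ys. y = 1 \<or> y < 2/3" by auto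
qed

lemma sum_piece_weight_student_ge:
  assumes "\<forall>y\<in>set ys. 1/3 < y \<and> (y = 1 \<or> y < 2/3)" "sum_list ys = 1 + d"
  shows "3 * b \<le> sum_list (map (piece_weight d b) ys)"
proof -
  have ge: "b \<le> piece_weight d b y" if "y \<in> set ys" for y
    using that assms piece_weight_ge by blast
  have one: "piece_weight d b 1 = 3 * b - 1" by (simp add: piece_weight_def)
  consider "ys = []" | y where "ys = [y]" | y z where "ys = [y, z]"
    | x y z zs where "ys = x # y # z # zs"
    by (cases ys rule: remdups_adj.cases) (auto, metis list.exhaust)
  thus ?thesis
  proof cases
    case 1
    thus ?thesis using assms d_pos by simp
  next
    case 2
    thus ?thesis using assms d_pos by auto
  next
    case (3 y z)
    show ?thesis
    \<comment> \<open>An uncut muffin weighs 3b - 1 and the other piece at least b \<ge> 1.\<close>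
    proof (cases "y = 1 \<or> z = 1")
      case True
      thus ?thesis using 3 ge[of y] ge[of z] one b_pos by auto
    next
      case False
      thus ?thesis using 3 assms piece_weight_student_ge[of y z] by auto
    qed
  next
    case (4 x y z zs)
    have "0 \<le> sum_list (map (piece_weight d b) zs)"
      using ge b_pos 4 by (intro sum_list_nonneg) force
    thus ?thesis using 4 ge[of x] ge[of y] ge[of z] by simp
  qed
qed

end

section \<open>Double counting of the weight\<close>

lemma sum_list_by_muffin:
  fixes h :: "real \<Rightarrow> int" and P :: "(nat \<times> nat \<times> real) list"
  assumes "\<forall>(i, j, a) \<in> set P. i < m"
  shows "(\<Sum>i<m. sum_list (map h [a. (i', j, a) \<leftarrow> P, i' = i])) = sum_list (map (\<lambda>(i, j, a). h a) P)"
  using assms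
proof (induction P)
  case (Cons q P)
  obtain i j a where q: "q = (i, j, a)" by (cases q) auto
  have "(\<Sum>k<m. sum_list (map h [a. (i', j, a) \<leftarrow> q # P, i' = k])) =
        (\<Sum>k<m. (if k = i then h a else 0) + sum_list (map h [a. (i', j, a) \<leftarrow> P, i' = k]))"
    by (rule sum.cong) (auto simp: q)
  thus ?case using Cons q by (simp add: sum.distrib)
qed simp

lemma sum_list_by_student:
  fixes h :: "real \<Rightarrow> int" and P :: "(nat \<times> nat \<times> real) list"
  assumes "\<forall>(i, j, a) \<in> set P. j < s"
  shows "(\<Sum>j<s. sum_list (map h [a. (i, j', a) \<leftarrow> P, j' = j])) = sum_list (map (\<lambda>(i, j, a). h a) P)"
  using assms
proof (induction P)
  case (Cons q P)
  obtain i j a where q: "q = (i, j, a)" by (cases q) auto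
  have "(\<Sum>k<s. sum_list (map h [a. (i, j', a) \<leftarrow> q # P, j' = k])) =
        (\<Sum>k<s. (if k = j then h a else 0) + sum_list (map h [a. (i, j', a) \<leftarrow> P, j' = k]))"
    by (rule sum.cong) (auto simp: q)
  thus ?case using Cons q by (simp add: sum.distrib)
qed simp

text \<open>Otherwise the total weight is at least 3bs by students and at most (3b - 1)m by muffins,
  so m/s \<ge> 3b/(3b - 1), against \<open>upper\<close>.\<close>

lemma muffin_division_piece_le_third:
  fixes b :: int and m s :: nat
  assumes P: "muffin_division m s P" and "0 < b" "0 < s"
    and lower: "(3 * real_of_int b + 1) / (3 * real_of_int b) \<le> real m / real s"
    and upper: "real m / real s < (3 * real_of_int b) / (3 * real_of_int b - 1)"
  shows "\<exists>(i, j, a) \<in> set P. a \<le> 1/3"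
proof (rule ccontr)
  assume "\<not> ?thesis"
  hence big: "\<forall>(i, j, a) \<in> set P. 1/3 < a" by force
  define d where "d = real m / real s - 1"
  have b1: "1 \<le> real_of_int b" using \<open>0 < b\<close> by linarith
  have "1 / (3 * real_of_int b) \<le> d"
    using lower b1 by (simp add: d_def add_divide_distrib)
  moreover have "0 < 1 / (3 * real_of_int b)" using b1 by simp
  ultimately interpret piece_weight_bounds d b
    using b1 \<open>0 < b\<close>
    by unfold_locales (linarith, simp, simp add: field_simps)
  have ranges: "\<forall>(i, j, a) \<in> set P. i < m \<and> j < s"
    and muffin: "\<And>i. i < m \<Longrightarrow> sum_list [a. (i', j, a) \<leftarrow> P, i' = i] = 1"
    and student: "\<And>j. j < s \<Longrightarrow> sum_list [a. (i, j', a) \<leftarrow> P, j' = j] = 1 + d"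
    using P unfolding muffin_division_def d_def by auto
  have size: "a = 1 \<or> a < 2/3" if "(i, j, a) \<in> set P" for i j a
  proof -
    have "i < m" using that ranges by auto
    moreover have "\<forall>y\<in>set [a. (i', j, a) \<leftarrow> P, i' = i]. 1/3 < y" using big by auto
    ultimately have "\<forall>y\<in>set [a. (i', j, a) \<leftarrow> P, i' = i]. y = 1 \<or> y < 2/3"
      using sum_piece_weight_muffin_le(2) muffin by blast
    thus ?thesis using that by force
  qed
  have "(\<Sum>j<s. 3 * b) \<le> (\<Sum>j<s. sum_list (map (piece_weight d b) [a. (i, j', a) \<leftarrow> P, j' = j]))"
  proof (rule sum_mono)
    fix j assume "j \<in> {..<s}"
    moreover have "\<forall>y\<in>set [a. (i, j', a) \<leftarrow> P, j' = j]. 1/3 < y \<and> (y = 1 \<or> y < 2/3)"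
      using big size by force
    ultimately show "3 * b \<le> sum_list (map (piece_weight d b) [a. (i, j', a) \<leftarrow> P, j' = j])"
      using sum_piece_weight_student_ge student by blast
  qed
  also have "\<dots> = sum_list (map (\<lambda>(i, j, a). piece_weight d b a) P)"
    using ranges by (intro sum_list_by_student) auto
  also have "\<dots> = (\<Sum>i<m. sum_list (map (piece_weight d b) [a. (i', j, a) \<leftarrow> P, i' = i]))"
    using ranges by (intro sum_list_by_muffin[symmetric]) auto
  also have "\<dots> \<le> (\<Sum>i<m. 3 * b - 1)"
  proof (rule sum_mono)
    fix i assume "i \<in> {..<m}"
    moreover have "\<forall>y\<in>set [a. (i', j, a) \<leftarrow> P, i' = i]. 1/3 < y" using big by auto
    ultimately show "sum_list (map (piece_weight d b) [a. (i', j, a) \<leftarrow> P, i' = i]) \<le> 3 * b - 1"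
      using sum_piece_weight_muffin_le(1) muffin by blast
  qed
  finally have "int s * (3 * b) \<le> int m * (3 * b - 1)" by simp
  hence "real_of_int (int s * (3 * b)) \<le> real_of_int (int m * (3 * b - 1))" by linarith
  hence "real s * (3 * b) \<le> real m * (3 * b - 1)" by simp
  thus False using upper b1 \<open>0 < s\<close> by (simp add: field_simps)
qed

section \<open>Networks of chains\<close>

text \<open>cuttable C m w: m muffins can be cut into pieces satisfying C and handed out so that
  student j holds w j. The muffins are added one at a time.\<close>

inductive cuttable :: "(real \<Rightarrow> bool) \<Rightarrow> nat \<Rightarrow> (nat \<Rightarrow> real) \<Rightarrow> bool" for C where
  none: "cuttable C 0 (\<lambda>_. 0)"
| muffin: "cuttable C m w \<Longrightarrow> \<forall>(j, a) \<in> set ps. C a \<Longrightarrow> sum_list (map snd ps) = 1 \<Longrightarrow>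
     cuttable C (Suc m) (\<lambda>j. w j + (\<Sum>(j', a)\<leftarrow>ps. if j = j' then a else 0))"

lemma cuttable_pieces:
  assumes "cuttable C m w"
  shows "\<exists>P. (\<forall>(i, j, a) \<in> set P. i < m \<and> C a) \<and>
    (\<forall>i<m. sum_list [a. (i', j, a) \<leftarrow> P, i' = i] = 1) \<and>
    (\<forall>j. sum_list [a. (i, j', a) \<leftarrow> P, j' = j] = w j)"
  using assms
proof induction
  case none
  show ?case by (rule exI[of _ "[]"]) simp
next
  case (muffin m w ps)
  then obtain P where P: "\<forall>(i, j, a) \<in> set P. i < m \<and> C a"
    "\<forall>i<m. sum_list [a. (i', j, a) \<leftarrow> P, i' = i] = 1"
    "\<forall>j. sum_list [a. (i, j', a) \<leftarrow> P, j' = j] = w j" by blast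
  define Q where "Q = map (\<lambda>(j, a). (m, j, a)) ps"
  have new: "[a. (i', j, a) \<leftarrow> Q, i' = i] = (if i = m then map snd ps else [])" for i
    unfolding Q_def by (induction ps) auto
  have old: "[a. (i', j, a) \<leftarrow> P, i' = m] = []" using P(1) by auto
  have st: "sum_list [a. (i, j', a) \<leftarrow> Q, j' = j] = (\<Sum>(j', a)\<leftarrow>ps. if j = j' then a else 0)" for j
    unfolding Q_def by (induction ps) auto
  have "\<forall>(i, j, a) \<in> set (P @ Q). i < Suc m \<and> C a"
    using P(1) muffin.hyps by (fastforce simp: Q_def)
  moreover have "\<forall>i<Suc m. sum_list [a. (i', j, a) \<leftarrow> P @ Q, i' = i] = 1"
    using P(2) muffin.hyps by (auto simp: less_Suc_eq new old simp del: concat_eq_Nil_conv)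
  moreover have "\<forall>j. sum_list [a. (i, j', a) \<leftarrow> P @ Q, j' = j] =
      w j + (\<Sum>(j', a)\<leftarrow>ps. if j = j' then a else 0)"
    using P(3) st by simp
  ultimately show ?case by blast
qed

text \<open>An abstract \<open>C\<close> serves both thresholds, \<open>1/3 < a\<close> and
  \<open>1/3 \<le> a\<close>. As \<open>C\<close> is upward closed, only the two ends of a chain
  have to be checked.\<close>

locale muffin_net =
  fixes C :: "real \<Rightarrow> bool" and d :: real
  assumes C_mono: "\<And>a a'. C a \<Longrightarrow> a \<le> a' \<Longrightarrow> C a'"
    and C_pos: "\<And>a. C a \<Longrightarrow> 0 < a"
    and d_nonneg: "0 \<le> d"
begin

text \<open>The first muffin gives \<open>a\<close> to \<open>u\<close> and \<open>1 - a\<close> to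
  the new student \<open>t\<close>, who still lacks \<open>a + d\<close>; the rest is a shorter
  chain from \<open>t\<close> starting with \<open>a + d\<close>. Inner pieces are at least
  \<open>a\<close> or at least \<open>a'\<close>.\<close>

lemma cuttable_chain:
  assumes "cuttable C m w" "C a" "C a'" "a + a' + real k * d = 1" "u < t" "v < t"
  shows "\<exists>w'. cuttable C (m + k + 1) w' \<and>
    (\<forall>j<t. w' j = w j + (if j = u then a else 0) + (if j = v then a' else 0)) \<and>
    (\<forall>j. t \<le> j \<and> j < t + k \<longrightarrow> w' j = w j + (1 + d)) \<and>
    (\<forall>j\<ge>t + k. w' j = w j)"
  using assms
proof (induction k arbitrary: m w a u t)
  case 0
  have "cuttable C (Suc m) (\<lambda>j. w j + (\<Sum>(j', b)\<leftarrow>[(u, a), (v, a')]. if j = j' then b else 0))"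
    using 0 by (intro cuttable.muffin) auto
  thus ?case using 0 by (intro exI conjI) auto
next
  case (Suc k)
  have kd: "0 \<le> real k * d" using d_nonneg by simp
  have "a' \<le> 1 - a" using Suc.prems(4) kd d_nonneg unfolding of_nat_Suc distrib_right by linarith
  define w\<^sub>1 where "w\<^sub>1 j = w j + (\<Sum>(j', b)\<leftarrow>[(u, a), (t, 1 - a)]. if j = j' then b else 0)" for j
  have w\<^sub>1: "w\<^sub>1 j = w j + ((if j = u then a else 0) + (if j = t then 1 - a else 0))" for j
    by (simp add: w\<^sub>1_def)
  have "cuttable C (Suc m) w\<^sub>1"
    unfolding w\<^sub>1_def using Suc.prems(1-3) C_mono \<open>a' \<le> 1 - a\<close> by (intro cuttable.muffin) auto
  moreover have "C (a + d)" using Suc.prems(2) C_mono d_nonneg by simp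
  moreover have "(a + d) + a' + real k * d = 1"
    using Suc.prems(4) by (simp add: algebra_simps)
  ultimately obtain w' where w': "cuttable C (Suc m + k + 1) w'"
    "\<forall>j<Suc t. w' j = w\<^sub>1 j + (if j = t then a + d else 0) + (if j = v then a' else 0)"
    "\<forall>j. Suc t \<le> j \<and> j < Suc t + k \<longrightarrow> w' j = w\<^sub>1 j + (1 + d)"
    "\<forall>j\<ge>Suc t + k. w' j = w\<^sub>1 j"
    using Suc.IH[OF _ _ Suc.prems(3) _ lessI less_SucI[OF Suc.prems(6)]] by blast
  show ?case
  proof (intro exI conjI allI impI)
    show "cuttable C (m + Suc k + 1) w'" using w'(1) by simp
    show "w' j = w j + (if j = u then a else 0) + (if j = v then a' else 0)" if "j < t" for j
      using w'(2) w\<^sub>1 that by auto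
    show "w' j = w j + (1 + d)" if "t \<le> j \<and> j < t + Suc k" for j
      using w'(2,3) w\<^sub>1 that Suc.prems(5,6) by (cases "j = t") auto
    show "w' j = w j" if "t + Suc k \<le> j" for j
      using w'(4) w\<^sub>1 that Suc.prems(5) by auto
  qed
qed

text \<open>The vertices, i.e. the three-piece students, are 0, ..., V - 1 and hold f j so far. The students
  V, ..., t - 1 are those inside the chains already laid and are fully served.\<close>

definition net :: "nat \<Rightarrow> nat \<Rightarrow> nat \<Rightarrow> (nat \<Rightarrow> real) \<Rightarrow> bool" where
  "net V m t f \<longleftrightarrow> V \<le> t \<and> (\<exists>w. cuttable C m w \<and> (\<forall>j<V. w j = f j) \<and>
     (\<forall>j. V \<le> j \<and> j < t \<longrightarrow> w j = 1 + d) \<and> (\<forall>j\<ge>t. w j = 0))"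

lemma net_empty: "net V 0 V (\<lambda>_. 0)"
  unfolding net_def by (auto intro!: exI[of _ "\<lambda>_. 0"] cuttable.none)

lemma net_chain:
  assumes "net V m t f" "C a" "C a'" "a + a' + real k * d = 1" "u < V" "v < V"
  shows "net V (m + (k + 1)) (t + k) (\<lambda>j. f j + ((if j = u then a else 0) + (if j = v then a' else 0)))"
proof -
  obtain w where w: "cuttable C m w" "\<forall>j<V. w j = f j"
    "\<forall>j. V \<le> j \<and> j < t \<longrightarrow> w j = 1 + d" "\<forall>j\<ge>t. w j = 0" and Vt: "V \<le> t"
    using assms(1) unfolding net_def by blast
  have uv: "u < t" "v < t" using assms Vt by auto
  obtain w' where w': "cuttable C (m + k + 1) w'"
    "\<forall>j<t. w' j = w j + (if j = u then a else 0) + (if j = v then a' else 0)"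
    "\<forall>j. t \<le> j \<and> j < t + k \<longrightarrow> w' j = w j + (1 + d)"
    "\<forall>j\<ge>t + k. w' j = w j"
    using cuttable_chain[OF w(1) assms(2-4) uv] by blast
  show ?thesis unfolding net_def
  proof (intro conjI exI allI impI)
    show "V \<le> t + k" using Vt by simp
    show "cuttable C (m + (k + 1)) w'" using w'(1) by simp
    show "w' j = f j + ((if j = u then a else 0) + (if j = v then a' else 0))" if "j < V" for j
      using that w'(2) w(2) Vt by auto
    show "w' j = 1 + d" if "V \<le> j \<and> j < t + k" for j
    proof (cases "j < t")
      case True
      thus ?thesis using that w'(2) w(3) assms(5,6) by auto
    next
      case False
      thus ?thesis using that w'(3) w(4) by auto
    qed
    show "w' j = 0" if "t + k \<le> j" for j
      using that w'(4) w(4) by auto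
  qed
qed

lemma net_chains:
  assumes "finite I" "net V m t f"
    and "\<And>i. i \<in> I \<Longrightarrow> u i < V \<and> v i < V \<and> C (a i) \<and> C (a' i) \<and> a i + a' i + real (k i) * d = 1"
  shows "net V (m + (\<Sum>i\<in>I. k i + 1)) (t + (\<Sum>i\<in>I. k i))
    (\<lambda>j. f j + (\<Sum>i\<in>I. (if j = u i then a i else 0) + (if j = v i then a' i else 0)))"
  using assms(1,3)
proof (induction I rule: finite_induct)
  case empty
  thus ?case using assms(2) by simp
next
  case (insert i I)
  have "net V (m + (\<Sum>i\<in>I. k i + 1)) (t + (\<Sum>i\<in>I. k i))
    (\<lambda>j. f j + (\<Sum>i\<in>I. (if j = u i then a i else 0) + (if j = v i then a' i else 0)))"
    using insert by blast
  from net_chain[OF this, of "a i" "a' i" "k i" "u i" "v i"] insert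
  show ?case by (simp add: add_ac)
qed

lemma net_thirds:
  assumes "net V m t f" "C (1/3)" "\<And>i. i < 3 * T \<Longrightarrow> h i < V"
  shows "net V (m + T) t (\<lambda>j. f j + (\<Sum>i<3 * T. if j = h i then 1/3 else 0))"
  using assms(3)
proof (induction T)
  case 0
  thus ?case using assms(1) by simp
next
  case (Suc T)
  let ?ps = "[(h (3 * T), 1/3), (h (3 * T + 1), 1/3), (h (3 * T + 2), 1/3 :: real)]"
  obtain w where w: "cuttable C (m + T) w"
    "\<forall>j<V. w j = f j + (\<Sum>i<3 * T. if j = h i then 1/3 else 0)"
    "\<forall>j. V \<le> j \<and> j < t \<longrightarrow> w j = 1 + d" "\<forall>j\<ge>t. w j = 0" and Vt: "V \<le> t"
    using Suc.IH Suc.prems unfolding net_def by fastforce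
  have h: "h (3 * T) < V" "h (3 * T + 1) < V" "h (3 * T + 2) < V" using Suc.prems by auto
  have c: "cuttable C (Suc (m + T)) (\<lambda>j. w j + (\<Sum>(j', b)\<leftarrow>?ps. if j = j' then b else 0))"
    using w(1) assms(2) by (intro cuttable.muffin) auto
  have step: "3 * Suc T = Suc (Suc (Suc (3 * T)))" by simp
  show ?case unfolding net_def
  proof (intro conjI exI allI impI)
    show "cuttable C (m + Suc T) (\<lambda>j. w j + (\<Sum>(j', b)\<leftarrow>?ps. if j = j' then b else 0))"
      using c by simp
    show "w j + (\<Sum>(j', b)\<leftarrow>?ps. if j = j' then b else 0) =
        f j + (\<Sum>i<3 * Suc T. if j = h i then 1/3 else 0)" if "j < V" for j
      using w(2) that unfolding step by simp
    show "w j + (\<Sum>(j', b)\<leftarrow>?ps. if j = j' then b else 0) = 1 + d" if "V \<le> j \<and> j < t" for j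
      using w(3) that h by auto
    show "w j + (\<Sum>(j', b)\<leftarrow>?ps. if j = j' then b else 0) = 0" if "t \<le> j" for j
      using w(4) that h Vt by auto
  qed (rule Vt)
qed

lemma net_division:
  assumes "net V m s f" "\<And>j. j < V \<Longrightarrow> f j = 1 + d" "1 + d = real m / real s"
  shows "\<exists>P. muffin_division m s P \<and> (\<forall>(i, j, a) \<in> set P. C a)"
proof -
  obtain w where w: "cuttable C m w" "\<forall>j<V. w j = f j"
    "\<forall>j. V \<le> j \<and> j < s \<longrightarrow> w j = 1 + d" "\<forall>j\<ge>s. w j = 0"
    using assms(1) unfolding net_def by blast
  obtain P where P: "\<forall>(i, j, a) \<in> set P. i < m \<and> C a"
    "\<forall>i<m. sum_list [a. (i', j, a) \<leftarrow> P, i' = i] = 1"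
    "\<forall>j. sum_list [a. (i, j', a) \<leftarrow> P, j' = j] = w j"
    using cuttable_pieces[OF w(1)] by blast
  \<comment> \<open>Students from \<open>s\<close> on hold 0 and pieces are positive, so none of
    them has a piece.\<close>
  have "j < s" if "(i, j, a) \<in> set P" for i j a
  proof (rule ccontr)
    assume "\<not> j < s"
    hence "sum_list [a. (i, j', a) \<leftarrow> P, j' = j] = 0" using P(3) w(4) by simp
    moreover have "\<forall>y\<in>set [a. (i, j', a) \<leftarrow> P, j' = j]. 0 < y" using P(1) C_pos by auto
    moreover have "a \<in> set [a. (i, j', a) \<leftarrow> P, j' = j]" using that by force
    ultimately show False
      by (metis less_irrefl less_imp_le sum_list_nonneg_eq_0_iff)
  qed
  moreover have "w j = 1 + d" if "j < s" for j
    using w(2,3) assms(2) that by (cases "j < V") auto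
  ultimately have "muffin_division m s P"
    using P C_pos assms(3) unfolding muffin_division_def by fastforce
  thus ?thesis using P(1) by blast
qed

end


section \<open>Divisions with large pieces\<close>

definition cyc_pred :: "nat \<Rightarrow> nat \<Rightarrow> nat" where
  "cyc_pred M i = (if i = 0 then M - 1 else i - 1)"

lemma cyc_pred_less: "i < M \<Longrightarrow> cyc_pred M i < M"
  unfolding cyc_pred_def by auto

text \<open>Edge \<open>i\<close> joins \<open>i\<close> to its predecessor, so vertex
  \<open>j\<close> meets edges \<open>j\<close> and \<open>Suc j\<close>. The last vertex meets edge
  0, which \<open>B M = B 0\<close> allows to be called edge \<open>M\<close>.\<close>

lemma sum_cyc_pred:
  fixes A B :: "nat \<Rightarrow> real"
  assumes "j < M" "B M = B 0"
  shows "(\<Sum>i<M. (if j = i then A i else 0) + (if j = cyc_pred M i then B i else 0)) = A j + B (Suc j)"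
proof -
  define i0 where "i0 = (if Suc j = M then 0 else Suc j)"
  have "(\<Sum>i<M. if j = cyc_pred M i then B i else 0) = (\<Sum>i<M. if i = i0 then B i else 0)"
    using assms by (intro sum.cong) (auto simp: cyc_pred_def i0_def)
  also have "\<dots> = B (Suc j)" using assms by (auto simp: i0_def)
  finally show ?thesis using assms by (simp add: sum.distrib)
qed

lemma sum_cyc_shift:
  fixes F :: "nat \<Rightarrow> 'a :: cancel_comm_monoid_add"
  assumes "F M = F 0"
  shows "(\<Sum>i<M. F (Suc i)) = (\<Sum>i<M. F i)"
proof -
  have "F 0 + (\<Sum>i<M. F (Suc i)) = (\<Sum>i<M. F i) + F M"
    using sum.lessThan_Suc_shift[of F M] by simp
  thus ?thesis using assms by (simp add: add.commute)
qed

text \<open>The indices i at which the rotation i -> i * L mod M wraps around are L of M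
  indices, spread as evenly as possible. They mark the positions of the exceptional edges.\<close>

definition rot :: "nat \<Rightarrow> nat \<Rightarrow> nat \<Rightarrow> nat" where
  "rot L M i = i * L mod M"

lemma rot_0 [simp]: "rot L M 0 = 0" and rot_self [simp]: "rot L M M = 0"
  unfolding rot_def by auto

lemma rot_less: "0 < M \<Longrightarrow> rot L M i < M"
  unfolding rot_def by simp

lemma rot_Suc:
  assumes "L < M"
  shows "rot L M (Suc i) = (if M \<le> rot L M i + L then rot L M i + L - M else rot L M i + L)"
proof -
  have "rot L M (Suc i) = (rot L M i + L) mod M"
    unfolding rot_def by (simp add: mod_add_left_eq add.commute mod_add_right_eq)
  moreover have "rot L M i < M" using assms by (intro rot_less) auto
  ultimately show ?thesis using assms by (auto simp: mod_if)
qed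

text \<open>Each step changes \<open>rot\<close> by L, less M at a wrap. Over a full period the
  changes cancel, so M times the number of wraps is M * L.\<close>

lemma sum_rot_wraps:
  assumes "L < M"
  shows "(\<Sum>i<M. if M \<le> rot L M i + L then 1 else 0 :: nat) = L"
proof -
  have "(\<Sum>i<M. int (rot L M (Suc i))) =
      (\<Sum>i<M. int (rot L M i) + (int L - int M * (if M \<le> rot L M i + L then 1 else 0)))"
    by (rule sum.cong) (auto simp: rot_Suc[OF assms] of_nat_diff)
  moreover have "(\<Sum>i<M. int (rot L M (Suc i))) = (\<Sum>i<M. int (rot L M i))"
    by (rule sum_cyc_shift) simp
  ultimately have "int M * int L = int M * (\<Sum>i<M. if M \<le> rot L M i + L then 1 else 0)"
    by (simp add: sum.distrib sum_subtractf flip: sum_distrib_left)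
  hence "int L = (\<Sum>i<M. if M \<le> rot L M i + L then 1 else 0)" using assms by simp
  also have "\<dots> = int (\<Sum>i<M. if M \<le> rot L M i + L then 1 else 0)"
    by (simp add: if_distrib cong: if_cong)
  finally show ?thesis by linarith
qed

lemma sum_bij_indicator:
  fixes x :: real and N :: nat
  assumes "bij_betw h {..<N} H"
  shows "(\<Sum>t<N. if j = h t then x else 0) = (if j \<in> H then x else 0)"
proof -
  have "finite H" using bij_betw_finite[OF assms] by simp
  thus ?thesis
    using sum.reindex_bij_betw[OF assms, of "\<lambda>y. if j = y then x else 0"] by simp
qed

lemma sum_pairs:
  fixes F :: "nat \<Rightarrow> real"
  shows "(\<Sum>t<q. F (2 * t) + F (2 * t + 1)) = (\<Sum>t<2 * q. F t)"
  by (induction q) auto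

lemma sum_lessThan_add:
  fixes F :: "nat \<Rightarrow> real"
  shows "(\<Sum>t<K + N. F t) = (\<Sum>t<K. F t) + (\<Sum>t<N. F (K + t))"
  by (induction N) auto

lemma ex_bij_lessThan: "finite H \<Longrightarrow> card H = N \<Longrightarrow> \<exists>h. bij_betw h {..<N} H"
  using ex_bij_betw_nat_finite[of H] by (auto simp: atLeast0LessThan)

section \<open>The constructions\<close>

lemma division_equal:
  assumes "0 < m"
  shows "\<exists>P. muffin_division m m P \<and> (\<forall>(i, j, a) \<in> set P. 1/3 < a)"
proof -
  interpret muffin_net "\<lambda>a. 1/3 < a" 0 by unfold_locales auto
  \<comment> \<open>With d = 0, each muffin is a chain with k = 0 whose two ends, the halves, go to
    the same student.\<close>
  have "net m (0 + (\<Sum>i<m. 0 + 1)) (m + (\<Sum>i<m. 0))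
      (\<lambda>j. 0 + (\<Sum>i<m. (if j = i then 1/2 else 0) + (if j = i then 1/2 else 0)))"
    by (rule net_chains[OF _ net_empty]) auto
  moreover have "(if j = i then 1/2 else 0) + (if j = i then 1/2 else 0) = (if j = i then 1 else 0 :: real)"
    for i j :: nat by simp
  ultimately have "net m m m (\<lambda>j. 0 + (\<Sum>i<m. if j = i then 1 else 0))" by simp
  thus ?thesis by (rule net_division) (use assms in auto)
qed

text \<open>The graph is a prism over an n-cycle: vertices i and n + i joined by a rung, and two rails. The
  chains with k = c - 1 are rungs. A chain with k = c has two ends of sum 2/3 + p. Rungs are split
  evenly, rails up to a correction g that balances the uneven rungs.\<close>

lemma division_prism:
  assumes n: "0 < n" and c: "0 < c" and s: "s + L = (3 * c + 2) * n" and L: "2 * L \<le> n"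
  shows "\<exists>P. muffin_division (s + n) s P \<and> (\<forall>(i, j, a) \<in> set P. 1/3 < a)"
proof -
  have s0: "0 < s"
  proof (rule ccontr)
    assume "\<not> 0 < s"
    hence "L = (3 * c) * n + 2 * n" using s by (simp add: algebra_simps)
    thus False using L n by simp
  qed
  have sr: "real s + real L = 3 * real c * real n + 2 * real n"
    using arg_cong[OF s, of real] by (simp add: algebra_simps)
  define d where "d = real n / real s"
  \<comment> \<open>Chosen so that a chain with k = c has ends of sum 1 - c d = 2/3 + p.\<close>
  define p where "p = (2 * real n - real L) / (3 * real s)"
  have cd: "real c * d = 1/3 - p"
    using sr s0 by (simp add: d_def p_def field_simps)
  have p0: "0 < p" using L n s0 by (simp add: p_def)
  have d0: "0 < d" using n s0 by (simp add: d_def)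
  interpret muffin_net "\<lambda>a. 1/3 < a" d using d0 by unfold_locales auto
  define r where "r = rot L n"
  define wrap where "wrap i \<longleftrightarrow> n \<le> r i + L" for i
  \<comment> \<open>The slope in \<open>r\<close> makes a wrap raise \<open>g\<close> by n/(2s) =
    d/2, offsetting the extra d/2 at the end of a rung with k = c - 1. The constant n - 1 centres
    \<open>g\<close> at 0.\<close>
  define g where "g i = (real n - 1 - 2 * real (r i)) / (4 * real s)" for i
  have Ln: "L < n" using L n by simp
  have r_lt: "r i < n" for i using rot_less n r_def by simp
  have g_step: "g i - g (Suc i) = real L / (2 * real s) - (if wrap i then d / 2 else 0)" for i
  proof -
    have "real (r (Suc i)) = real (r i) + real L - (if wrap i then real n else 0)"
      using rot_Suc[OF Ln, of i] by (auto simp: wrap_def r_def of_nat_diff)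
    thus ?thesis unfolding g_def d_def using s0 by (simp add: diff_divide_distrib add_divide_distrib)
  qed
  have g_bound: "\<bar>g i\<bar> < p / 2" for i
  proof -
    have "\<bar>real n - 1 - 2 * real (r i)\<bar> < real n" using r_lt[of i] by linarith
    hence "\<bar>g i\<bar> < real n / (4 * real s)"
      using s0 by (simp add: g_def abs_divide divide_strict_right_mono)
    \<comment> \<open>This inequality is equivalent to 2L \<le> n.\<close>
    also have "\<dots> \<le> p / 2" using L s0 by (simp add: p_def field_simps)
    finally show ?thesis .
  qed
  define a where "a i = 1/3 + p / 2 + g i" for i
  define a' where "a' i = 1/3 + p / 2 - g i" for i
  define k where "k i = (if wrap i then c - 1 else c)" for i
  define e where "e i = (1 - real (k i) * d) / 2" for i
  have e: "e i = 1/3 + p / 2 + (if wrap i then d / 2 else 0)" for i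
    using cd c by (simp add: e_def k_def of_nat_diff left_diff_distrib)
  have rail: "1/3 < a i" "1/3 < a' i" "a i + a' i + real c * d = 1" for i
    using g_bound[of i] cd by (auto simp: a_def a'_def abs_less_iff)
  have rung: "1/3 < e i" "e i + e i + real (k i) * d = 1" for i
    using e[of i] p0 d0 by (auto simp: e_def)
  have rail': "i \<in> {..<n} \<Longrightarrow> i < 2 * n \<and> cyc_pred n i < 2 * n \<and>
      1/3 < a i \<and> 1/3 < a' i \<and> a i + a' i + real c * d = 1"
    "i \<in> {..<n} \<Longrightarrow> n + i < 2 * n \<and> n + cyc_pred n i < 2 * n \<and>
      1/3 < a i \<and> 1/3 < a' i \<and> a i + a' i + real c * d = 1" for i
    using rail[of i] cyc_pred_less[of i n] by auto
  have rung': "i \<in> {..<n} \<Longrightarrow> i < 2 * n \<and> n + i < 2 * n \<and>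
      1/3 < e i \<and> 1/3 < e i \<and> e i + e i + real (k i) * d = 1" for i
    using rung[of i] by auto
  define f where "f j = 0
     + (\<Sum>i<n. (if j = i then a i else 0) + (if j = cyc_pred n i then a' i else 0))
     + (\<Sum>i<n. (if j = n + i then a i else 0) + (if j = n + cyc_pred n i then a' i else 0))
     + (\<Sum>i<n. (if j = i then e i else 0) + (if j = n + i then e i else 0))" for j
  have chains: "net (2 * n) (0 + (\<Sum>i<n. c + 1) + (\<Sum>i<n. c + 1) + (\<Sum>i<n. k i + 1))
     (2 * n + (\<Sum>i<n. c) + (\<Sum>i<n. c) + (\<Sum>i<n. k i)) f"
    unfolding f_def
    by (rule net_chains[OF finite_lessThan net_chains[OF finite_lessThan
          net_chains[OF finite_lessThan net_empty rail'(1)] rail'(2)] rung'])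
  have k: "(\<Sum>i<n. k i) + L = n * c"
  proof -
    have "(\<Sum>i<n. k i) + (\<Sum>i<n. if n \<le> rot L n i + L then 1 else 0) = (\<Sum>i<n. c)"
      unfolding sum.distrib[symmetric]
      by (rule sum.cong) (use c in \<open>auto simp: k_def wrap_def r_def\<close>)
    thus ?thesis using sum_rot_wraps[OF Ln] by simp
  qed
  have "(\<Sum>i<n. k i + 1) = (\<Sum>i<n. k i) + n"
    by (simp only: sum.distrib) simp
  \<comment> \<open>The 2n vertices and the inner students make s; each of the 3n chains has one
    muffin more than inner students, hence s + n muffins.\<close>
  hence "0 + (\<Sum>i<n. c + 1) + (\<Sum>i<n. c + 1) + (\<Sum>i<n. k i + 1) = s + n"
    "2 * n + (\<Sum>i<n. c) + (\<Sum>i<n. c) + (\<Sum>i<n. k i) = s"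
    using k s by (simp_all add: algebra_simps del: add_Suc_right sum.lessThan_Suc)
  with chains have net: "net (2 * n) (s + n) s f" by (simp only:)
  have "f j = 1 + d" if "j < 2 * n" for j
  proof -
    define l where "l = (if j < n then j else j - n)"
    have l: "l < n" using that by (auto simp: l_def)
    have a'n: "a' n = a' 0" by (simp add: a'_def g_def r_def)
    have "f j = a l + a' (Suc l) + e l"
    proof (cases "j < n")
      case True
      have "f j = (\<Sum>i<n. (if j = i then a i else 0) + (if j = cyc_pred n i then a' i else 0))
           + (\<Sum>i<n. if j = i then e i else 0)"
        unfolding f_def using True by (simp add: sum.distrib)
      thus ?thesis using sum_cyc_pred[OF l a'n, of a] True by (simp add: l_def)
    next
      case False
      then obtain j' where j': "j = n + j'" using le_Suc_ex by (metis not_less)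
      have "j \<noteq> i \<and> j \<noteq> cyc_pred n i" if "i < n" for i
        using False that cyc_pred_less by blast
      hence "f j = (\<Sum>i<n. (if j' = i then a i else 0) + (if j' = cyc_pred n i then a' i else 0))
           + (\<Sum>i<n. if j' = i then e i else 0)"
        unfolding f_def using j' by (simp add: sum.distrib)
      thus ?thesis using sum_cyc_pred[OF l a'n, of a] j' l by (simp add: l_def)
    qed
    also have "\<dots> = 1 + 3 / 2 * p + real L / (2 * real s)"
      using g_step[of l] unfolding a_def a'_def e by (simp split: if_splits)
    also have "\<dots> = 1 + d"
      using s0 by (simp add: p_def d_def field_simps)
    finally show ?thesis .
  qed
  moreover have "1 + d = real (s + n) / real s"
    using s0 by (simp add: d_def field_simps)
  ultimately show ?thesis using net_division[OF net] by blast
qed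

text \<open>The graph is a 2n-cycle in which some edges are doubled, together with a matching of the
  vertices of degree two. The chains with k = c - 1 are undoubled edges of the cycle. A gap is doubled
  when the correction g it has to carry may exceed the capacity p/2 of a single edge, which
  happens only just before a chain with k = c - 1.\<close>

lemma division_cycle:
  assumes n: "0 < n" and c: "0 < c" and s: "s + L = (3 * c + 2) * n"
    and L: "n \<le> 2 * L" "L < 2 * n"
  shows "\<exists>P. muffin_division (s + n) s P \<and> (\<forall>(i, j, a) \<in> set P. 1/3 < a)"
proof -
  have s0: "0 < s"
  proof (rule ccontr)
    assume "\<not> 0 < s"
    hence "L = (3 * c) * n + 2 * n" using s by (simp add: algebra_simps)
    thus False using L n by simp
  qed
  have sr: "real s + real L = 3 * real c * real n + 2 * real n"
    using arg_cong[OF s, of real] by (simp add: algebra_simps)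
  define d where "d = real n / real s"
  define p where "p = (2 * real n - real L) / (3 * real s)"
  have cd: "real c * d = 1/3 - p"
    using sr s0 by (simp add: d_def p_def field_simps)
  have p0: "0 < p" using L n s0 by (simp add: p_def)
  have d0: "0 < d" using n s0 by (simp add: d_def)
  interpret muffin_net "\<lambda>a. 1/3 < a" d using d0 by unfold_locales auto
  define r where "r = rot L (2 * n)"
  \<comment> \<open>These edges have k = c - 1. Cyclically, \<open>r i < L\<close> means that the
    rotation wrapped on the step into \<open>i\<close>.\<close>
  define large where "large i \<longleftrightarrow> r i < L" for i
  define dbl where "dbl i \<longleftrightarrow> \<not> large i \<and> large (Suc i)" for i
  \<comment> \<open>A wrap raises this by 2n/(2s) = d, the extra length of a \<open>large\<close>
    edge. The constant makes it positive exactly on \<open>large\<close> edges.\<close>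
  define g\<^sub>0 where "g\<^sub>0 i = (2 * real L - 2 * real (r i) - 1) / (4 * real s)" for i
  define g where "g i = p / 2 + g\<^sub>0 i" for i
  define h where "h i = (if dbl i then g i / 2 else g i)" for i
  have r_lt: "r i < 2 * n" for i using rot_less n r_def by simp
  have large_Suc: "large (Suc i) \<longleftrightarrow> 2 * n \<le> r i + L" for i
    using rot_Suc[OF L(2), of i] r_lt[of i] L by (auto simp: large_def r_def)
  have r_end: "r (2 * n) = 0" "r 0 = 0" by (simp_all add: r_def)
  have r_end': "r (Suc (2 * n)) = r (Suc 0)"
    using rot_Suc[OF L(2), of "2 * n"] rot_Suc[OF L(2), of 0] by (simp add: r_def)
  have g_step: "g i - g (Suc i) = real L / (2 * real s) - (if large (Suc i) then d else 0)" for i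
  proof -
    have "real (r (Suc i)) = real (r i) + real L - (if large (Suc i) then 2 * real n else 0)"
      using rot_Suc[OF L(2), of i] large_Suc[of i] by (auto simp: r_def of_nat_diff)
    thus ?thesis unfolding g_def g\<^sub>0_def d_def using s0 by (simp add: diff_divide_distrib add_divide_distrib)
  qed
  have d4: "d = 4 * real n / (4 * real s)"
    by (simp add: d_def)
  have h_bound: "- p / 2 < h i \<and> h i < p / 2 + (if large i then d else 0)" for i
  proof -
    have s4: "0 < 4 * real s" using s0 by simp
    consider "large i" | "dbl i" | "\<not> large i" "\<not> dbl i" by blast
    thus ?thesis
    proof cases
      case 1
      hence rL: "real (r i) + 1 \<le> real L" by (simp add: large_def)
      have "0 < g\<^sub>0 i" using rL s0 by (simp add: g\<^sub>0_def)
      moreover have "g\<^sub>0 i < d"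
        unfolding g\<^sub>0_def d4 using s4 L by (intro divide_strict_right_mono) linarith+
      ultimately show ?thesis using 1 p0 by (simp add: h_def g_def dbl_def)
    next
      case 2
      hence rL: "real L \<le> real (r i)" "real (r i) + 1 \<le> 2 * real n"
        using r_lt[of i] by (auto simp: dbl_def large_def)
      have "g\<^sub>0 i < 0" using rL s0 by (simp add: g\<^sub>0_def divide_neg_pos)
      moreover have "- (3 * (p / 2)) < g\<^sub>0 i"
      proof -
        have "- (3 * (p / 2)) = (2 * real L - 4 * real n) / (4 * real s)"
          using s0 by (simp add: p_def field_simps)
        also have "\<dots> < g\<^sub>0 i"
          unfolding g\<^sub>0_def using s4 rL by (intro divide_strict_right_mono) auto
        finally show ?thesis .
      qed
      ultimately show ?thesis using 2 p0 by (simp add: h_def g_def dbl_def)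
    next
      case 3
      hence rL: "real L \<le> real (r i)" "real (r i) + real L + 1 \<le> 2 * real n"
        using r_lt[of i] large_Suc[of i] by (auto simp: dbl_def large_def)
      have "g\<^sub>0 i < 0" using rL s0 by (simp add: g\<^sub>0_def divide_neg_pos)
      moreover have "- (2 * (p / 2)) < g\<^sub>0 i"
      proof -
        \<comment> \<open>Inserting r \<le> 2n - L - 1 reduces this to 4n < 8L + 3, which follows
          from n \<le> 2L.\<close>
        have "(4 * real L - 8 * real n) / 3 < 2 * real L - 2 * real (r i) - 1"
          using L rL by (simp add: field_simps)
        hence "(4 * real L - 8 * real n) / 3 / (4 * real s) < g\<^sub>0 i"
          unfolding g\<^sub>0_def using s4 by (rule divide_strict_right_mono)
        thus ?thesis using s0 by (simp add: p_def field_simps)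
      qed
      ultimately show ?thesis using 3 p0 by (simp add: h_def g_def)
    qed
  qed
  define a where "a i = 1/3 + p / 2 + h i" for i
  define a' where "a' i = 1/3 + p / 2 - h i + (if large i then d else 0)" for i
  define k where "k i = (if large i then c - 1 else c)" for i
  have conn: "1/3 < a i" "1/3 < a' i" "a i + a' i + real (k i) * d = 1" for i
    using h_bound[of i] cd c by (auto simp: a_def a'_def k_def of_nat_diff left_diff_distrib)
  define D where "D = {i \<in> {..<2 * n}. dbl i}"
  define H where "H = {i \<in> {..<2 * n}. \<not> dbl i \<and> \<not> dbl (Suc i)}"
  define q where "q = n - card D"
  have dbl_excl: "\<not> (dbl i \<and> dbl (Suc i))" for i by (auto simp: dbl_def)
  have dbl_end: "dbl (2 * n) = dbl 0"
    using r_end r_end' by (simp add: dbl_def large_def)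
  \<comment> \<open>Doubled edges are never adjacent, so each covers two vertices of its own;
    \<open>H\<close> holds the vertices left over, to be matched in \<open>q\<close> pairs.\<close>
  have card_DH: "2 * card D + card H = 2 * n"
  proof -
    have D: "card D = (\<Sum>i<2 * n. if dbl i then 1 else 0)"
      unfolding D_def by (simp add: sum.If_cases Int_def)
    have D': "(\<Sum>i<2 * n. if dbl (Suc i) then 1 else 0) = card D"
      unfolding D by (rule sum_cyc_shift) (simp add: dbl_end)
    have H: "card H = (\<Sum>i<2 * n. if \<not> dbl i \<and> \<not> dbl (Suc i) then 1 else 0)"
      unfolding H_def by (simp add: sum.If_cases Int_def)
    have "card D + card D + card H = (\<Sum>i<2 * n. (if dbl i then 1 else 0)
        + (if dbl (Suc i) then 1 else 0) + (if \<not> dbl i \<and> \<not> dbl (Suc i) then 1 else 0))"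
      by (simp only: sum.distrib D' H flip: D)
    also have "\<dots> = (\<Sum>i<2 * n. 1)"
      using dbl_excl by (intro sum.cong) auto
    finally have "card D + card D + card H = (\<Sum>i<2 * n. 1)" .
    thus ?thesis by simp
  qed
  hence card_H: "card H = 2 * q" and q: "q + card D = n" by (auto simp: q_def)
  obtain \<phi> where \<phi>: "bij_betw \<phi> {..<2 * q} H"
    using ex_bij_lessThan[of H] card_H by (auto simp: H_def)
  have \<phi>_less: "\<phi> t < 2 * n" if "t < 2 * q" for t
    using \<phi> that by (auto simp: bij_betw_def H_def)
  define f where "f j = 0
     + (\<Sum>i<2 * n. (if j = i then a i else 0) + (if j = cyc_pred (2 * n) i then a' i else 0))
     + (\<Sum>i\<in>D. (if j = i then a i else 0) + (if j = cyc_pred (2 * n) i then a' i else 0))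
     + (\<Sum>t<q. (if j = \<phi> (2 * t) then 1/3 + p / 2 else 0) + (if j = \<phi> (2 * t + 1) then 1/3 + p / 2 else 0))"
    for j
  have conn': "i \<in> {..<2 * n} \<Longrightarrow> i < 2 * n \<and> cyc_pred (2 * n) i < 2 * n \<and>
      1/3 < a i \<and> 1/3 < a' i \<and> a i + a' i + real (k i) * d = 1"
    "i \<in> D \<Longrightarrow> i < 2 * n \<and> cyc_pred (2 * n) i < 2 * n \<and>
      1/3 < a i \<and> 1/3 < a' i \<and> a i + a' i + real (k i) * d = 1" for i
    using conn[of i] cyc_pred_less[of i "2 * n"] by (auto simp: D_def)
  have float: "t \<in> {..<q} \<Longrightarrow> \<phi> (2 * t) < 2 * n \<and> \<phi> (2 * t + 1) < 2 * n \<and>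
      1/3 < 1/3 + p / 2 \<and> 1/3 < 1/3 + p / 2 \<and> 1/3 + p / 2 + (1/3 + p / 2) + real c * d = 1" for t
    using \<phi>_less[of "2 * t"] \<phi>_less[of "2 * t + 1"] p0 cd by auto
  have finD: "finite D" by (simp add: D_def)
  have k_D: "k i = c" if "i \<in> D" for i using that by (auto simp: D_def dbl_def k_def)
  have chains: "net (2 * n) (0 + (\<Sum>i<2 * n. k i + 1) + (\<Sum>i\<in>D. k i + 1) + (\<Sum>t<q. c + 1))
     (2 * n + (\<Sum>i<2 * n. k i) + (\<Sum>i\<in>D. k i) + (\<Sum>t<q. c)) f"
    unfolding f_def
    by (rule net_chains[OF finite_lessThan net_chains[OF finD
          net_chains[OF finite_lessThan net_empty conn'(1)] conn'(2)] float])
  have k: "(\<Sum>i<2 * n. k i) + L = 2 * n * c"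
  proof -
    \<comment> \<open>The shift by one turns \<open>large (Suc i)\<close> into a wrap at
      \<open>i\<close>, which \<open>sum_rot_wraps\<close> counts.\<close>
    have "(\<Sum>i<2 * n. k i) = (\<Sum>i<2 * n. k (Suc i))"
      using r_end by (intro sum_cyc_shift[symmetric]) (simp add: k_def large_def)
    moreover have "(\<Sum>i<2 * n. k (Suc i)) + (\<Sum>i<2 * n. if 2 * n \<le> rot L (2 * n) i + L then 1 else 0)
        = (\<Sum>i<2 * n. c)"
      unfolding sum.distrib[symmetric]
      by (rule sum.cong) (use c in \<open>auto simp: k_def large_Suc r_def\<close>)
    ultimately show ?thesis using sum_rot_wraps[OF L(2)] by simp
  qed
  have k': "(\<Sum>i<2 * n. k i + 1) = (\<Sum>i<2 * n. k i) + 2 * n"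
    by (simp only: sum.distrib) simp
  have D: "(\<Sum>i\<in>D. k i + 1) = card D * (c + 1)" "(\<Sum>i\<in>D. k i) = card D * c"
    using k_D by simp_all
  have Dq: "card D * (c + 1) + q * (c + 1) = n * (c + 1)" "card D * c + q * c = n * c"
    using q by (metis add.commute add_mult_distrib)+
  have "0 + (\<Sum>i<2 * n. k i + 1) + (\<Sum>i\<in>D. k i + 1) + (\<Sum>t<q. c + 1) = s + n"
    "2 * n + (\<Sum>i<2 * n. k i) + (\<Sum>i\<in>D. k i) + (\<Sum>t<q. c) = s"
    unfolding D k' using k Dq s by (simp_all add: algebra_simps)
  with chains have net: "net (2 * n) (s + n) s f" by (simp only:)
  have "f j = 1 + d" if j: "j < 2 * n" for j
  proof -
    have a'_end: "a' (2 * n) = a' 0"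
      using dbl_end r_end by (simp add: a'_def h_def g_def g\<^sub>0_def large_def)
    have 1: "(\<Sum>i<2 * n. (if j = i then a i else 0) + (if j = cyc_pred (2 * n) i then a' i else 0))
        = a j + a' (Suc j)"
      using sum_cyc_pred[OF j a'_end] .
    have "(\<Sum>i\<in>D. (if j = i then a i else 0) + (if j = cyc_pred (2 * n) i then a' i else 0)) =
       (\<Sum>i<2 * n. (if j = i then (if dbl i then a i else 0) else 0) +
         (if j = cyc_pred (2 * n) i then (if dbl i then a' i else 0) else 0))"
      unfolding D_def sum.inter_filter[OF finite_lessThan] by (rule sum.cong) auto
    also have "\<dots> = (if dbl j then a j else 0) + (if dbl (Suc j) then a' (Suc j) else 0)"
      by (rule sum_cyc_pred[OF j]) (simp add: a'_end dbl_end)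
    finally have 2: "(\<Sum>i\<in>D. (if j = i then a i else 0) + (if j = cyc_pred (2 * n) i then a' i else 0)) =
      (if dbl j then a j else 0) + (if dbl (Suc j) then a' (Suc j) else 0)" .
    have 3: "(\<Sum>t<q. (if j = \<phi> (2 * t) then 1/3 + p / 2 else 0)
        + (if j = \<phi> (2 * t + 1) then 1/3 + p / 2 else 0)) =
        (if \<not> dbl j \<and> \<not> dbl (Suc j) then 1/3 + p / 2 else 0)"
      unfolding sum_pairs[of "\<lambda>t. if j = \<phi> t then 1/3 + p / 2 else 0"] sum_bij_indicator[OF \<phi>]
      using j by (simp add: H_def)
    \<comment> \<open>A doubled edge carries \<open>g / 2\<close> twice, so doubled or not the cycle
      contributes \<open>g j - g (Suc j)\<close>; the third piece adds only 1/3 + p/2.\<close>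
    have "f j = 3 * (1/3 + p / 2) + (g j - g (Suc j) + (if large (Suc j) then d else 0))"
      unfolding f_def 1 2 3 unfolding a_def a'_def h_def using dbl_excl[of j]
      by (auto simp: dbl_def)
    also have "\<dots> = 1 + 3 / 2 * p + real L / (2 * real s)"
      using g_step[of j] by simp
    also have "\<dots> = 1 + d"
      using s0 by (simp add: p_def d_def field_simps)
    finally show ?thesis .
  qed
  moreover have "1 + d = real (s + n) / real s"
    using s0 by (simp add: d_def field_simps)
  ultimately show ?thesis using net_division[OF net] by blast
qed

text \<open>A V-cycle of chains, and K further chains that lie in a wrapping vertex, except
  for one end of size 1/3. These K ends and the 3T thirds are as many as the remaining vertices,
  and each of those receives one of them.\<close>

lemma division_thirds:
  assumes n: "0 < n" and s: "s = (3 * c + 2) * n + T" and T: "T \<le> n"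
  shows "\<exists>P. muffin_division (s + n) s P \<and> (\<forall>(i, j, a) \<in> set P. 1/3 \<le> a)"
proof -
  have s0: "0 < s" using n s by simp
  have sr: "real s = 3 * real c * real n + 2 * real n + real T"
    using arg_cong[OF s, of real] by (simp add: algebra_simps)
  define d where "d = real n / real s"
  \<comment> \<open>With T muffins in three pieces and the others in two, there are 2(s + n) + T
    pieces, so 2n + T students get a third one. Of the 3n chains, V form the cycle and K
    remain.\<close>
  define V where "V = 2 * n + T"
  define K where "K = n - T"
  have V0: "0 < V" and KV: "K < V" using n T by (auto simp: V_def K_def)
  have VK: "real V + real K = 3 * real n" using T by (simp add: V_def K_def)
  have cd: "real c * d = 1/3 - real V / (3 * real s)"
    using sr s0 by (simp add: d_def V_def field_simps)
  have d0: "0 < d" using n s0 by (simp add: d_def)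
  interpret muffin_net "\<lambda>a. 1/3 \<le> a" d using d0 by unfold_locales auto
  define r where "r = rot K V"
  define wrap where "wrap i \<longleftrightarrow> V \<le> r i + K" for i
  have r_lt: "r i < V" for i using rot_less V0 r_def by simp
  have r_step: "real (r (Suc i)) = real (r i) + real K - (if wrap i then real V else 0)" for i
    using rot_Suc[OF KV, of i] by (auto simp: wrap_def r_def of_nat_diff)
  \<comment> \<open>The two cycle pieces at a vertex sum to 2/3 + (V + K)/(3s), less V/(3s) at a
    wrap; \<open>x\<close> exceeds 1/3 by just that deficit.\<close>
  define a where "a i = 1/3 + (real V - real (r i)) / (3 * real s)" for i
  define a' where "a' i = 1/3 + real (r i) / (3 * real s)" for i
  define x where "x = 1/3 + real V / (3 * real s)"
  have conn: "1/3 \<le> a i" "1/3 \<le> a' i" "a i + a' i + real c * d = 1" for i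
    using r_lt[of i] cd by (auto simp: a_def a'_def diff_divide_distrib intro!: divide_right_mono)
  have x: "1/3 \<le> x" "x + 1/3 + real c * d = 1" using cd by (auto simp: x_def)
  define D where "D = {i \<in> {..<V}. wrap i}"
  define H where "H = {i \<in> {..<V}. \<not> wrap i}"
  have card_D: "card D = K"
    using sum_rot_wraps[OF KV] unfolding D_def by (simp add: sum.If_cases Int_def wrap_def r_def)
  have "D \<union> H = {..<V}" "D \<inter> H = {}" "finite D" "finite H" by (auto simp: D_def H_def)
  hence "card D + card H = card {..<V}" by (metis card_Un_disjoint)
  hence card_H: "card H = K + 3 * T" using card_D T by (simp add: V_def K_def)
  obtain \<psi> where \<psi>: "bij_betw \<psi> {..<K} D"
    using ex_bij_lessThan[of D] card_D by (auto simp: D_def)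
  \<comment> \<open>The first K values take the far ends of the extra chains, the other 3T the
    thirds.\<close>
  obtain \<phi> where \<phi>: "bij_betw \<phi> {..<K + 3 * T} H"
    using ex_bij_lessThan[of H] card_H by (auto simp: H_def)
  have \<psi>_less: "\<psi> t < V" if "t < K" for t
    using \<psi> that by (auto simp: bij_betw_def D_def)
  have \<phi>_less: "\<phi> t < V" if "t < K + 3 * T" for t
    using \<phi> that by (auto simp: bij_betw_def H_def)
  have conn': "i \<in> {..<V} \<Longrightarrow> i < V \<and> cyc_pred V i < V \<and>
      1/3 \<le> a i \<and> 1/3 \<le> a' i \<and> a i + a' i + real c * d = 1" for i
    using conn[of i] cyc_pred_less[of i V] by auto
  have inner': "t \<in> {..<K} \<Longrightarrow> \<psi> t < V \<and> \<phi> t < V \<and>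
      1/3 \<le> x \<and> 1/3 \<le> (1/3 :: real) \<and> x + 1/3 + real c * d = 1" for t
    using x \<psi>_less[of t] \<phi>_less[of t] by auto
  define f where "f j = 0
     + (\<Sum>i<V. (if j = i then a i else 0) + (if j = cyc_pred V i then a' i else 0))
     + (\<Sum>t<K. (if j = \<psi> t then x else 0) + (if j = \<phi> t then 1/3 else 0))
     + (\<Sum>t<3 * T. if j = \<phi> (K + t) then 1/3 else 0)" for j
  have "net V (0 + (\<Sum>i<V. c + 1) + (\<Sum>t<K. c + 1) + T) (V + (\<Sum>i<V. c) + (\<Sum>t<K. c)) f"
    unfolding f_def
    by (rule net_thirds[OF net_chains[OF finite_lessThan
          net_chains[OF finite_lessThan net_empty conn'] inner']]) (use \<phi>_less in auto)
  moreover have "V * (c + 1) + K * (c + 1) + T = s + n" "V + V * c + K * c = s"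
  proof -
    have "V + K = 3 * n" using T by (simp add: V_def K_def)
    hence *: "V * u + K * u = 3 * n * u" for u by (metis add_mult_distrib)
    show "V * (c + 1) + K * (c + 1) + T = s + n" "V + V * c + K * c = s"
      using *[of c] *[of "c + 1"] s by (simp_all add: V_def algebra_simps)
  qed
  ultimately have net: "net V (s + n) s f" by simp
  have "f j = 1 + d" if j: "j < V" for j
  proof -
    have 1: "(\<Sum>i<V. (if j = i then a i else 0) + (if j = cyc_pred V i then a' i else 0))
        = a j + a' (Suc j)"
      by (rule sum_cyc_pred[OF j]) (simp add: a'_def r_def)
    have "(\<Sum>t<K. (if j = \<psi> t then x else 0) + (if j = \<phi> t then 1/3 else 0))
       + (\<Sum>t<3 * T. if j = \<phi> (K + t) then 1/3 else 0)
       = (\<Sum>t<K. if j = \<psi> t then x else 0) + (\<Sum>t<K + 3 * T. if j = \<phi> t then 1/3 else 0)"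
      by (simp add: sum.distrib sum_lessThan_add)
    also have "\<dots> = (if wrap j then x else 1/3)"
      unfolding sum_bij_indicator[OF \<psi>] sum_bij_indicator[OF \<phi>]
      using j by (simp add: D_def H_def)
    finally have "f j = a j + a' (Suc j) + (if wrap j then x else 1/3)"
      unfolding f_def 1 by simp
    also have "\<dots> = 1 + (real V + real K) / (3 * real s)"
      unfolding a_def a'_def x_def r_step by (simp add: diff_divide_distrib add_divide_distrib)
    also have "\<dots> = 1 + d"
      using s0 unfolding VK by (simp add: d_def)
    finally show ?thesis .
  qed
  moreover have "1 + d = real (s + n) / real s"
    using s0 by (simp add: d_def field_simps)
  ultimately show ?thesis using net_division[OF net] by blast
qed

section \<open>The value of f\<close>

lemma muffin_division_piece:
  assumes "muffin_division m s P" "0 < m"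
  shows "\<exists>(i, j, a) \<in> set P. a = smallest_piece P"
    and "\<And>i j a. (i, j, a) \<in> set P \<Longrightarrow> smallest_piece P \<le> a \<and> a \<le> 1"
proof -
  have "sum_list [a. (i', j, a) \<leftarrow> P, i' = 0] = 1"
    using assms by (simp add: muffin_division_def)
  hence "P \<noteq> []" by auto
  hence "smallest_piece P \<in> set (map (\<lambda>(i, j, a). a) P)"
    unfolding smallest_piece_def by (intro Min_in) auto
  thus "\<exists>(i, j, a) \<in> set P. a = smallest_piece P" by force
  fix i j a assume a: "(i, j, a) \<in> set P"
  hence "smallest_piece P \<le> a"
    unfolding smallest_piece_def by (intro Min_le) force+
  moreover have "a \<le> 1"
  proof -
    have "i < m" "\<forall>(i, j, a) \<in> set P. 0 < a"
      using a assms(1) unfolding muffin_division_def by auto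
    moreover from this have "\<forall>y\<in>set [a. (i', j, a) \<leftarrow> P, i' = i]. 0 \<le> y" by force
    moreover have "a \<in> set [a. (i', j, a) \<leftarrow> P, i' = i]" using a by force
    ultimately have "a \<le> sum_list [a. (i', j, a) \<leftarrow> P, i' = i]"
      using member_le_sum_list by (metis (no_types, lifting))
    thus ?thesis using \<open>i < m\<close> assms(1) unfolding muffin_division_def by auto
  qed
  ultimately show "smallest_piece P \<le> a \<and> a \<le> 1" by blast
qed

lemma smallest_piece_le_muffin_f:
  assumes "muffin_division m s P" "0 < m"
  shows "smallest_piece P \<le> muffin_f m s"
proof -
  have "smallest_piece Q \<le> 1" if "muffin_division m s Q" for Q
    using muffin_division_piece[OF that assms(2)] by fastforce
  hence "bdd_above {smallest_piece P | P. muffin_division m s P}"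
    by (intro bdd_aboveI[of _ 1]) blast
  thus ?thesis unfolding muffin_f_def using assms by (intro cSup_upper) blast
qed

lemma muffin_f_gt_third:
  assumes "\<exists>P. muffin_division m s P \<and> (\<forall>(i, j, a) \<in> set P. 1/3 < a)" "0 < m"
  shows "1/3 < muffin_f m s"
proof -
  obtain P where P: "muffin_division m s P" "\<forall>(i, j, a) \<in> set P. 1/3 < a" using assms by blast
  hence "1/3 < smallest_piece P" using muffin_division_piece(1)[OF P(1) assms(2)] by fastforce
  thus ?thesis using smallest_piece_le_muffin_f[OF P(1) assms(2)] by simp
qed

lemma muffin_f_eq_third:
  assumes "\<exists>P. muffin_division m s P \<and> (\<forall>(i, j, a) \<in> set P. 1/3 \<le> a)" "0 < m"
    and "\<And>P. muffin_division m s P \<Longrightarrow> \<exists>(i, j, a) \<in> set P. a \<le> 1/3"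
  shows "muffin_f m s = 1/3"
proof (rule antisym)
  obtain P where P: "muffin_division m s P" "\<forall>(i, j, a) \<in> set P. 1/3 \<le> a" using assms by blast
  hence "1/3 \<le> smallest_piece P" using muffin_division_piece(1)[OF P(1) assms(2)] by fastforce
  thus "1/3 \<le> muffin_f m s" using smallest_piece_le_muffin_f[OF P(1) assms(2)] by simp
  have "smallest_piece Q \<le> 1/3" if "muffin_division m s Q" for Q
    using assms(3)[OF that] muffin_division_piece(2)[OF that assms(2)] by force
  thus "muffin_f m s \<le> 1/3" unfolding muffin_f_def using P(1) by (intro cSup_least) blast+
qed

text \<open>In terms of d = n/s the interval is 1/(3b) \<le> d < 1/(3b - 1); clearing denominators
  leaves integers.\<close>

lemma interval_iff:
  fixes n s :: nat and b :: int
  assumes "0 < s" "0 < b"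
  shows "(3 * real_of_int b + 1) / (3 * real_of_int b) \<le> real (s + n) / real s \<and>
         real (s + n) / real s < (3 * real_of_int b) / (3 * real_of_int b - 1) \<longleftrightarrow>
         int s \<le> 3 * b * int n \<and> (3 * b - 1) * int n < int s"
proof -
  have b: "0 < real_of_int b" "0 < 3 * real_of_int b - 1" using assms by linarith+
  have "(3 * real_of_int b + 1) / (3 * real_of_int b) \<le> real (s + n) / real s \<longleftrightarrow>
      real_of_int (int s) \<le> real_of_int (3 * b * int n)"
    using b assms(1) by (simp add: field_simps)
  moreover have "real (s + n) / real s < (3 * real_of_int b) / (3 * real_of_int b - 1) \<longleftrightarrow>
      real_of_int ((3 * b - 1) * int n) < real_of_int (int s)"
    using b assms(1) by (simp add: field_simps)
  ultimately show ?thesis by (simp only: of_int_le_iff of_int_less_iff)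
qed

theorem theorem13:
  fixes m s :: nat
  assumes "0 < m" and "0 < s"
    and "\<lfloor>2 * real m / real s\<rfloor> = 2"
  shows "(muffin_f m s = 1/3 \<longleftrightarrow>
           (\<exists>b::int. 0 < b \<and>
              (3 * real_of_int b + 1) / (3 * real_of_int b) \<le> real m / real s \<and>
              real m / real s < (3 * real_of_int b) / (3 * real_of_int b - 1)))
       \<and> ((\<nexists>b::int. 0 < b \<and>
              (3 * real_of_int b + 1) / (3 * real_of_int b) \<le> real m / real s \<and>
              real m / real s < (3 * real_of_int b) / (3 * real_of_int b - 1))
          \<longrightarrow> muffin_f m s > 1/3)"
proof -
  have "2 \<le> 2 * real m / real s" "2 * real m / real s < 3" using assms(3) by linarith+
  hence "real s \<le> real m" "2 * real m < 3 * real s" using assms(2) by (simp_all add: field_simps)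
  hence sm: "s \<le> m" "2 * m < 3 * s" by linarith+
  define n where "n = m - s"
  have m: "m = s + n" and n2: "2 * n < s" using sm by (auto simp: n_def)
  define I where "I b \<longleftrightarrow> 0 < b \<and>
      (3 * real_of_int b + 1) / (3 * real_of_int b) \<le> real m / real s \<and>
      real m / real s < (3 * real_of_int b) / (3 * real_of_int b - 1)" for b :: int
  have I: "I b \<longleftrightarrow> 0 < b \<and> int s \<le> 3 * b * int n \<and> (3 * b - 1) * int n < int s" for b
    unfolding I_def m using interval_iff[OF assms(2), of b n] by blast
  have "((\<exists>b. I b) \<and> muffin_f m s = 1/3) \<or> ((\<nexists>b. I b) \<and> 1/3 < muffin_f m s)"
  proof (cases "n = 0")
    case True
    hence "1/3 < muffin_f m s"
      using muffin_f_gt_third[OF division_equal[OF assms(2)] assms(2)] m by simp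
    moreover have "\<not> I b" for b unfolding I using True assms(2) by simp
    ultimately show ?thesis by blast
  next
    case False
    hence n: "0 < n" by simp
    \<comment> \<open>Dividing s - 1 rather than s places s in the block 3cn < s \<le> 3(c + 1)n.
      The interval for b = c + 1 is the last third of this block, where e \<ge> 2n.\<close>
    define c where "c = (s - 1) div (3 * n)"
    define e where "e = (s - 1) mod (3 * n)"
    have s: "s = 3 * c * n + e + 1"
      using div_mult_mod_eq[of "s - 1" "3 * n"] assms(2) by (simp add: c_def e_def algebra_simps)
    have e: "e < 3 * n" using n by (simp add: e_def)
    show ?thesis
    proof (cases "e < 2 * n")
      case True
      define L where "L = 2 * n - e - 1"
      have sL: "s + L = (3 * c + 2) * n" using s True by (simp add: L_def algebra_simps)
      have L: "L < 2 * n" using n by (simp add: L_def)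
      \<comment> \<open>For c = 0 this case would give s = e + 1 \<le> 2n, against m/s <
        3/2.\<close>
      have "0 < c" using s n2 True by (cases c) auto
      hence "\<exists>P. muffin_division m s P \<and> (\<forall>(i, j, a) \<in> set P. 1/3 < a)"
        using division_prism[OF n _ sL] division_cycle[OF n _ sL _ L] m by (cases "2 * L \<le> n") auto
      moreover have "\<not> I b" for b
      proof
        assume "I b"
        hence b: "int s \<le> 3 * b * int n" "(3 * b - 1) * int n < int s" using I by auto
        have si: "int s = 3 * int c * int n + int e + 1" using s by simp
        show False
        \<comment> \<open>If b \<le> c, then 3bn \<le> 3cn < s; otherwise (3b - 1)n \<ge> (3c + 2)n
          \<ge> s.\<close>
        proof (cases "b \<le> int c")
          case True
          hence "b * int n \<le> int c * int n" by (intro mult_right_mono) auto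
          thus False using b(1) si by simp
        next
          case False
          hence "(int c + 1) * int n \<le> b * int n" by (intro mult_right_mono) auto
          thus False using b(2) si \<open>e < 2 * n\<close> by (simp add: algebra_simps)
        qed
      qed
      ultimately show ?thesis using muffin_f_gt_third assms(1) by blast
    next
      case False
      define T where "T = e + 1 - 2 * n"
      have sT: "s = (3 * c + 2) * n + T" and T: "0 < T" "T \<le> n"
        using s e False by (simp_all add: T_def algebra_simps)
      have "int s = (3 * int c + 2) * int n + int T"
        using arg_cong[OF sT, of int] by (simp add: algebra_simps)
      hence Ic: "I (int c + 1)" unfolding I using T by (simp add: algebra_simps)
      have "muffin_f m s = 1/3"
        using division_thirds[OF n sT T(2)] muffin_division_piece_le_third[of m s _ "int c + 1"] Ic[unfolded I_def]
          assms m by (intro muffin_f_eq_third) auto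
      thus ?thesis using Ic by blast
    qed
  qed
  hence "(muffin_f m s = 1/3 \<longleftrightarrow> (\<exists>b. I b)) \<and> ((\<nexists>b. I b) \<longrightarrow> 1/3 < muffin_f m s)" by auto
  thus ?thesis unfolding I_def .
qed

end
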